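(* Let $r\in\mathfrak g\otimes\mathfrak g$ be a quasitriangular $r$-matrix on a Lie algebra $\mathfrak g$ and let $\lambda$ be a left Lie algebra action of $\mathfrak g$ on a manifold $Y$. If the 2-tensor field $\lambda(r)$ on $Y$ is skew-symmetric, it is Poisson, and $(Y,-\lambda(r),\lambda)$ is a left $(\mathfrak g,r)$-Poisson space.
   Context: Everything is over $\mathbf k=\mathbb R$ (smooth) or $\mathbb C$ (holomorphic), finite dimensional. $r=\sum_ix_i\otimes y_i\in\mathfrak g\otimes\mathfrak g$ is a quasitriangular $r$-matrix if its symmetric part is ad-invariant and $[r_{12},r_{13}]+[r_{12},r_{23}]+[r_{13},r_{23}]=0$ in $U(\mathfrak g)^{\otimes3}$; then $\delta_r(x)=\mathrm{ad}_xr=\sum_i([x,x_i]\otimes y_i+x_i\otimes[x,y_i])$ makes $(\mathfrak g,\delta_r)$ a Lie bialgebra. A left action of $\mathfrak g$ on $Y$ is a Lie algebra anti-homomorphism $\lambda$ from $\mathfrak g$ to the vector fields on $Y$; $\lambda(r)=\sum_i\lambda(x_i)\otimes\lambda(y_i)$. A left $(\mathfrak g,r)$-Poisson space is a triple $(Y,\pi_Y,\lambda)$ with $(Y,\pi_Y)$ a Poisson manifold and $\lambda$ a left action of $\mathfrak g$ on $Y$ with $[\lambda(x),\pi_Y]=\lambda(\delta_r(x))$ for all $x\in\mathfrak g$, where $\wedge^2\mathfrak g\subset\mathfrak g\otimes\mathfrak g$ via $u\wedge v=u\otimes v-v\otimes u$ and $\lambda(u\wedge v)=\lambda(u)\wedge\lambda(v)$.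 *)

theory Defs
  imports "HOL-Analysis.Analysis" "HOL-Library.Poly_Mapping"
begin

text \<open>
  The ground field is a type of sort \<open>{real_normed_field, euclidean_space}\<close>.  By the
  Gelfand--Mazur theorem (a commutative, finite-dimensional real division algebra with
  multiplicative norm) the types of this sort are, up to isometric isomorphism, exactly
  \<^typ>\<open>real\<close> and \<^typ>\<open>complex\<close>.  All derivatives below are derivatives with respect to the
  ground field, so that \<open>smooth\<close> means smooth over the reals and holomorphic over the complex
  numbers.
\<close>

section \<open>Manifolds\<close>

text \<open>
  The coordinate space of dimension \<open>n\<close> is realised as in \<^const>\<open>Euclidean_space\<close>, so that
  \<open>n\<close> is an arbitrary natural number (including \<open>0\<close>).
\<close>

definition coord_space :: "nat \<Rightarrow> (nat \<Rightarrow> 'k::{real_normed_field,euclidean_space}) set" where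
  "coord_space n = {x. \<forall>i\<ge>n. x i = 0}"

definition partial ::
  "nat \<Rightarrow> ((nat \<Rightarrow> 'k) \<Rightarrow> 'k) \<Rightarrow> (nat \<Rightarrow> 'k) \<Rightarrow> 'k::{real_normed_field,euclidean_space}" where
  "partial i f x = deriv (\<lambda>t. f (x(i := t))) (x i)"

text \<open>
  To be used for \<open>S\<close> open in \<^term>\<open>coord_space n\<close>.  Over the complex numbers a
  continuous function that is holomorphic in each variable is holomorphic, so \<open>smooth_on\<close> is
  holomorphy there.
\<close>

fun Ck_on ::
  "nat \<Rightarrow> nat \<Rightarrow> (nat \<Rightarrow> 'k) set \<Rightarrow> ((nat \<Rightarrow> 'k) \<Rightarrow> 'k::{real_normed_field,euclidean_space}) \<Rightarrow> bool"
where
  "Ck_on n 0 S f \<longleftrightarrow> continuous_on S f"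
| "Ck_on n (Suc m) S f \<longleftrightarrow> continuous_on S f \<and>
     (\<forall>i<n. (\<forall>x\<in>S. (\<lambda>t. f (x(i := t))) field_differentiable (at (x i))) \<and>
            Ck_on n m S (partial i f))"

definition smooth_on ::
  "nat \<Rightarrow> (nat \<Rightarrow> 'k) set \<Rightarrow> ((nat \<Rightarrow> 'k) \<Rightarrow> 'k::{real_normed_field,euclidean_space}) \<Rightarrow> bool" where
  "smooth_on n S f \<longleftrightarrow> (\<forall>m. Ck_on n m S f)"

record ('a, 'k) manifold_data =
  mtop :: "'a topology"
  mdim :: nat
  matlas :: "('a set \<times> ('a \<Rightarrow> nat \<Rightarrow> 'k)) set"

definition manifold ::
  "('a, 'k::{real_normed_field,euclidean_space}) manifold_data \<Rightarrow> bool" where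
  "manifold M \<longleftrightarrow>
     Hausdorff_space (mtop M) \<and> second_countable (mtop M) \<and>
     topspace (mtop M) = (\<Union>(U, \<phi>)\<in>matlas M. U) \<and>
     (\<forall>(U, \<phi>)\<in>matlas M.
        openin (mtop M) U \<and>
        openin (top_of_set (coord_space (mdim M))) (\<phi> ` U) \<and>
        homeomorphic_map (subtopology (mtop M) U) (top_of_set (\<phi> ` U)) \<phi>) \<and>
     (\<forall>(U, \<phi>)\<in>matlas M. \<forall>(V, \<psi>)\<in>matlas M. \<forall>i<mdim M.
        smooth_on (mdim M) (\<phi> ` (U \<inter> V)) (\<lambda>x. \<psi> (inv_into U \<phi> x) i))"

text \<open>
  A smooth function on an open set \<open>U\<close> is given by a total function of which only the values
  on \<open>U\<close> matter.
\<close>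

definition smooth_fun ::
  "('a, 'k::{real_normed_field,euclidean_space}) manifold_data \<Rightarrow> 'a set \<Rightarrow> ('a \<Rightarrow> 'k) \<Rightarrow> bool" where
  "smooth_fun M U f \<longleftrightarrow> openin (mtop M) U \<and>
     (\<forall>(V, \<psi>)\<in>matlas M. smooth_on (mdim M) (\<psi> ` (U \<inter> V)) (\<lambda>x. f (inv_into V \<psi> x)))"

definition smooth_near ::
  "('a, 'k::{real_normed_field,euclidean_space}) manifold_data \<Rightarrow> 'a \<Rightarrow> ('a \<Rightarrow> 'k) \<Rightarrow> bool" where
  "smooth_near M p f \<longleftrightarrow> (\<exists>U. p \<in> U \<and> smooth_fun M U f)"


section \<open>Vector fields and 2-tensor fields\<close>

text \<open>
  Tangent vectors at \<open>p\<close> are the derivations on germs at \<open>p\<close> of smooth functions.  A germ is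
  given by a function that is smooth near \<open>p\<close>; on all other functions a tangent vector is set
  to \<open>0\<close>, which makes equality of tangent vectors equality of functions.  In particular the
  space is \<open>{0}\<close> if \<open>p\<close> is not a point of \<open>M\<close>, so that vector fields and tensor fields vanish
  there by convention.
\<close>

definition tangent_space ::
  "('a, 'k::{real_normed_field,euclidean_space}) manifold_data \<Rightarrow> 'a \<Rightarrow> (('a \<Rightarrow> 'k) \<Rightarrow> 'k) set" where
  "tangent_space M p = {v.
     (\<forall>f g. smooth_near M p f \<longrightarrow> smooth_near M p g \<longrightarrow>
        v (\<lambda>q. f q + g q) = v f + v g \<and>
        v (\<lambda>q. f q * g q) = f p * v g + g p * v f) \<and>
     (\<forall>c f. smooth_near M p f \<longrightarrow> v (\<lambda>q. c * f q) = c * v f) \<and>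
     (\<forall>f g U. smooth_near M p f \<longrightarrow> smooth_near M p g \<longrightarrow>
        openin (mtop M) U \<longrightarrow> p \<in> U \<longrightarrow> (\<forall>q\<in>U. f q = g q) \<longrightarrow> v f = v g) \<and>
     (\<forall>f. \<not> smooth_near M p f \<longrightarrow> v f = 0)}"

type_synonym ('a, 'k) vfield = "'a \<Rightarrow> ('a \<Rightarrow> 'k) \<Rightarrow> 'k"

definition vector_field ::
  "('a, 'k::{real_normed_field,euclidean_space}) manifold_data \<Rightarrow> ('a, 'k) vfield \<Rightarrow> bool" where
  "vector_field M X \<longleftrightarrow> (\<forall>p. X p \<in> tangent_space M p) \<and>
     (\<forall>U f. smooth_fun M U f \<longrightarrow> smooth_fun M U (\<lambda>p. X p f))"

definition vf_bracket ::
  "('a, 'k::{real_normed_field,euclidean_space}) manifold_data \<Rightarrow>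
     ('a, 'k) vfield \<Rightarrow> ('a, 'k) vfield \<Rightarrow> ('a, 'k) vfield" where
  "vf_bracket M X Y = (\<lambda>p f. if smooth_near M p f
     then X p (\<lambda>q. Y q f) - Y p (\<lambda>q. X q f) else 0)"

text \<open>
  The tensor \<open>v \<otimes> w\<close> of tangent vectors is the bilinear map \<open>(f, g) \<mapsto> v f * w g\<close> on germs, and
  \<open>tangent_space2 M p\<close> is the tensor square of the tangent space.
\<close>

definition tangent_space2 ::
  "('a, 'k::{real_normed_field,euclidean_space}) manifold_data \<Rightarrow> 'a \<Rightarrow>
     (('a \<Rightarrow> 'k) \<Rightarrow> ('a \<Rightarrow> 'k) \<Rightarrow> 'k) set" where
  "tangent_space2 M p = {b. \<exists>vs. set vs \<subseteq> tangent_space M p \<times> tangent_space M p \<and>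
     b = (\<lambda>f g. \<Sum>(v, w)\<leftarrow>vs. v f * w g)}"

type_synonym ('a, 'k) tfield = "'a \<Rightarrow> ('a \<Rightarrow> 'k) \<Rightarrow> ('a \<Rightarrow> 'k) \<Rightarrow> 'k"

definition tensor_field ::
  "('a, 'k::{real_normed_field,euclidean_space}) manifold_data \<Rightarrow> ('a, 'k) tfield \<Rightarrow> bool" where
  "tensor_field M B \<longleftrightarrow> (\<forall>p. B p \<in> tangent_space2 M p) \<and>
     (\<forall>U f g. smooth_fun M U f \<longrightarrow> smooth_fun M U g \<longrightarrow> smooth_fun M U (\<lambda>p. B p f g))"

definition skew_symmetric :: "('a, 'k::ab_group_add) tfield \<Rightarrow> bool" where
  "skew_symmetric B \<longleftrightarrow> (\<forall>p f g. B p f g = - B p g f)"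

definition neg_field :: "('a, 'k::ab_group_add) tfield \<Rightarrow> ('a, 'k) tfield" where
  "neg_field B = (\<lambda>p f g. - B p f g)"

text \<open>
  On \<open>B = V \<otimes> W\<close> this is \<open>[X, V] \<otimes> W + V \<otimes> [X, W]\<close>, so it is the Schouten bracket \<open>[X, B]\<close>
  when \<open>B\<close> is a bivector field.
\<close>

definition lie_derivative ::
  "('a, 'k::{real_normed_field,euclidean_space}) manifold_data \<Rightarrow>
     ('a, 'k) vfield \<Rightarrow> ('a, 'k) tfield \<Rightarrow> ('a, 'k) tfield" where
  "lie_derivative M X B = (\<lambda>p f g. if smooth_near M p f \<and> smooth_near M p g
     then X p (\<lambda>q. B q f g) - B p (\<lambda>q. X q f) g - B p f (\<lambda>q. X q g) else 0)"

text \<open>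
  The Poisson bracket of local functions is \<open>{f, g} = \<pi>(df, dg)\<close>, that is \<open>\<lambda>q. \<pi> q f g\<close>.
\<close>

definition poisson ::
  "('a, 'k::{real_normed_field,euclidean_space}) manifold_data \<Rightarrow> ('a, 'k) tfield \<Rightarrow> bool" where
  "poisson M \<pi> \<longleftrightarrow> tensor_field M \<pi> \<and> skew_symmetric \<pi> \<and>
     (\<forall>p f g h. smooth_near M p f \<longrightarrow> smooth_near M p g \<longrightarrow> smooth_near M p h \<longrightarrow>
        \<pi> p f (\<lambda>q. \<pi> q g h) + \<pi> p g (\<lambda>q. \<pi> q h f) + \<pi> p h (\<lambda>q. \<pi> q f g) = 0)"


section \<open>Lie algebras and quasitriangular r-matrices\<close>

locale lie_algebra = vector_space smul
  for smul :: "'k::field \<Rightarrow> 'g::ab_group_add \<Rightarrow> 'g" +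
  fixes bracket :: "'g \<Rightarrow> 'g \<Rightarrow> 'g"
  assumes finite_dim: "\<exists>B. finite B \<and> span B = UNIV"
    and bracket_add_left: "bracket (x + y) z = bracket x z + bracket y z"
    and bracket_add_right: "bracket x (y + z) = bracket x y + bracket x z"
    and bracket_scale_left: "bracket (smul c x) y = smul c (bracket x y)"
    and bracket_scale_right: "bracket x (smul c y) = smul c (bracket x y)"
    and bracket_self: "bracket x x = 0"
    and jacobi: "bracket x (bracket y z) + bracket y (bracket z x) + bracket z (bracket x y) = 0"

text \<open>
  A list \<open>[(x\<^sub>1, y\<^sub>1), \<dots>, (x\<^sub>m, y\<^sub>m)]\<close> of pairs stands for the element
  \<open>x\<^sub>1 \<otimes> y\<^sub>1 + \<dots> + x\<^sub>m \<otimes> y\<^sub>m\<close> of \<open>\<gg> \<otimes> \<gg>\<close>.  Here \<open>\<gg> \<otimes> \<gg>\<close> is the free vector space on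
  \<open>\<gg> \<times> \<gg>\<close> modulo the subspace \<open>bilinear_relations\<close>; as the generators below carry an
  arbitrary coefficient \<open>s\<close>, the additive closure is a subspace.
\<close>

inductive_set bilinear_relations :: "('k::field \<Rightarrow> 'g::ab_group_add \<Rightarrow> 'g) \<Rightarrow> ('g \<times> 'g \<Rightarrow>\<^sub>0 'k) set"
  for smul where
  zero: "0 \<in> bilinear_relations smul"
| add: "u \<in> bilinear_relations smul \<Longrightarrow> v \<in> bilinear_relations smul \<Longrightarrow>
    u + v \<in> bilinear_relations smul"
| add_left: "Poly_Mapping.single (x + x', y) s - Poly_Mapping.single (x, y) s
    - Poly_Mapping.single (x', y) s \<in> bilinear_relations smul"
| add_right: "Poly_Mapping.single (x, y + y') s - Poly_Mapping.single (x, y) s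
    - Poly_Mapping.single (x, y') s \<in> bilinear_relations smul"
| scale_left: "Poly_Mapping.single (smul c x, y) s - Poly_Mapping.single (x, y) (c * s)
    \<in> bilinear_relations smul"
| scale_right: "Poly_Mapping.single (x, smul c y) s - Poly_Mapping.single (x, y) (c * s)
    \<in> bilinear_relations smul"

definition tensor_zero :: "('k::field \<Rightarrow> 'g::ab_group_add \<Rightarrow> 'g) \<Rightarrow> ('g \<times> 'g) list \<Rightarrow> bool" where
  "tensor_zero smul u \<longleftrightarrow> (\<Sum>(x, y)\<leftarrow>u. Poly_Mapping.single (x, y) 1) \<in> bilinear_relations smul"

definition ad2 :: "('g \<Rightarrow> 'g \<Rightarrow> 'g) \<Rightarrow> 'g \<Rightarrow> ('g \<times> 'g) list \<Rightarrow> ('g \<times> 'g) list" where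
  "ad2 bracket x u = concat (map (\<lambda>(a, b). [(bracket x a, b), (a, bracket x b)]) u)"

definition symmetric_part ::
  "('k::field \<Rightarrow> 'g \<Rightarrow> 'g) \<Rightarrow> ('g \<times> 'g) list \<Rightarrow> ('g \<times> 'g) list" where
  "symmetric_part smul u =
     map (\<lambda>(a, b). (smul (1/2) a, b)) (u @ map (\<lambda>(a, b). (b, a)) u)"

text \<open>
  \<open>T(\<gg>)\<^sup>\<otimes>\<^sup>3\<close> is a quotient of the monoid algebra of triples of words over \<open>\<gg>\<close> under
  concatenation, and \<open>U(\<gg>)\<^sup>\<otimes>\<^sup>3\<close> is the quotient of that monoid algebra by the two-sided ideal
  generated, in each of the three slots, by linearity of \<open>x \<mapsto> [x]\<close> and the relations
  \<open>x y - y x = [x, y]\<close>.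
\<close>

instantiation list :: (type) monoid_add
begin
definition zero_list :: "'a list" where "zero_list = []"
definition plus_list :: "'a list \<Rightarrow> 'a list \<Rightarrow> 'a list" where "plus_list u v = u @ v"
instance by standard (simp_all add: zero_list_def plus_list_def)
end

type_synonym 'g words3 = "'g list \<times> 'g list \<times> 'g list"

definition slots :: "('g list \<Rightarrow> 'g words3) set" where
  "slots = {\<lambda>w. (w, [], []), \<lambda>w. ([], w, []), \<lambda>w. ([], [], w)}"

inductive_set U3_ideal ::
  "('k::field \<Rightarrow> 'g::ab_group_add \<Rightarrow> 'g) \<Rightarrow> ('g \<Rightarrow> 'g \<Rightarrow> 'g) \<Rightarrow> ('g words3 \<Rightarrow>\<^sub>0 'k) set"
  for smul bracket where
  zero: "0 \<in> U3_ideal smul bracket"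
| add: "u \<in> U3_ideal smul bracket \<Longrightarrow> v \<in> U3_ideal smul bracket \<Longrightarrow>
    u + v \<in> U3_ideal smul bracket"
| mult: "u \<in> U3_ideal smul bracket \<Longrightarrow> a * u * b \<in> U3_ideal smul bracket"
| rel_add: "e \<in> slots \<Longrightarrow> Poly_Mapping.single (e [x + y]) 1
    - Poly_Mapping.single (e [x]) 1 - Poly_Mapping.single (e [y]) 1 \<in> U3_ideal smul bracket"
| rel_scale: "e \<in> slots \<Longrightarrow> Poly_Mapping.single (e [smul c x]) 1
    - Poly_Mapping.single (e [x]) c \<in> U3_ideal smul bracket"
| rel_bracket: "e \<in> slots \<Longrightarrow> Poly_Mapping.single (e [x, y]) 1 - Poly_Mapping.single (e [y, x]) 1
    - Poly_Mapping.single (e [bracket x y]) 1 \<in> U3_ideal smul bracket"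

definition r12 :: "('g \<times> 'g) list \<Rightarrow> 'g words3 \<Rightarrow>\<^sub>0 'k::field" where
  "r12 r = (\<Sum>(x, y)\<leftarrow>r. Poly_Mapping.single ([x], [y], []) 1)"

definition r13 :: "('g \<times> 'g) list \<Rightarrow> 'g words3 \<Rightarrow>\<^sub>0 'k::field" where
  "r13 r = (\<Sum>(x, y)\<leftarrow>r. Poly_Mapping.single ([x], [], [y]) 1)"

definition r23 :: "('g \<times> 'g) list \<Rightarrow> 'g words3 \<Rightarrow>\<^sub>0 'k::field" where
  "r23 r = (\<Sum>(x, y)\<leftarrow>r. Poly_Mapping.single ([], [x], [y]) 1)"

definition commutator :: "'b::ring \<Rightarrow> 'b \<Rightarrow> 'b" where
  "commutator a b = a * b - b * a"

definition quasitriangular ::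
  "('k::field \<Rightarrow> 'g::ab_group_add \<Rightarrow> 'g) \<Rightarrow> ('g \<Rightarrow> 'g \<Rightarrow> 'g) \<Rightarrow> ('g \<times> 'g) list \<Rightarrow> bool" where
  "quasitriangular smul bracket r \<longleftrightarrow>
     (\<forall>x. tensor_zero smul (ad2 bracket x (symmetric_part smul r))) \<and>
     commutator (r12 r) (r13 r) + commutator (r12 r) (r23 r) + commutator (r13 r) (r23 r)
       \<in> U3_ideal smul bracket"


section \<open>Actions and Poisson spaces\<close>

definition left_action ::
  "('k \<Rightarrow> 'g::ab_group_add \<Rightarrow> 'g) \<Rightarrow> ('g \<Rightarrow> 'g \<Rightarrow> 'g) \<Rightarrow>
     ('a, 'k::{real_normed_field,euclidean_space}) manifold_data \<Rightarrow>
     ('g \<Rightarrow> ('a, 'k) vfield) \<Rightarrow> bool" where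
  "left_action smul bracket M lam \<longleftrightarrow>
     (\<forall>x. vector_field M (lam x)) \<and>
     (\<forall>x y. lam (x + y) = (\<lambda>p f. lam x p f + lam y p f)) \<and>
     (\<forall>c x. lam (smul c x) = (\<lambda>p f. c * lam x p f)) \<and>
     (\<forall>x y. lam (bracket x y) = (\<lambda>p f. - vf_bracket M (lam x) (lam y) p f))"

definition act2 ::
  "('g \<Rightarrow> ('a, 'k::{real_normed_field,euclidean_space}) vfield) \<Rightarrow> ('g \<times> 'g) list \<Rightarrow>
     ('a, 'k) tfield" where
  "act2 lam u = (\<lambda>p f g. \<Sum>(x, y)\<leftarrow>u. lam x p f * lam y p g)"

text \<open>
  In the definition below \<^term>\<open>ad2 bracket x r\<close> is the cobracket \<open>\<delta>\<^sub>r(x)\<close>.  On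
  \<open>u \<and> v = u \<otimes> v - v \<otimes> u\<close> the map \<^const>\<open>act2\<close> gives \<open>\<lambda>(u) \<and> \<lambda>(v)\<close>.
\<close>

definition left_poisson_space ::
  "('k \<Rightarrow> 'g::ab_group_add \<Rightarrow> 'g) \<Rightarrow> ('g \<Rightarrow> 'g \<Rightarrow> 'g) \<Rightarrow> ('g \<times> 'g) list \<Rightarrow>
     ('a, 'k::{real_normed_field,euclidean_space}) manifold_data \<Rightarrow> ('a, 'k) tfield \<Rightarrow>
     ('g \<Rightarrow> ('a, 'k) vfield) \<Rightarrow> bool" where
  "left_poisson_space smul bracket r M \<pi> lam \<longleftrightarrow>
     manifold M \<and> poisson M \<pi> \<and> left_action smul bracket M lam \<and>
     (\<forall>x. lie_derivative M (lam x) \<pi> = act2 lam (ad2 bracket x r))"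

end

theory Submission
  imports Defs
begin

text \<open>
  Write \<open>r = \<Sum>\<^sub>i x\<^sub>i \<otimes> y\<^sub>i\<close>, \<open>X\<^sub>i = \<lambda>(x\<^sub>i)\<close>, \<open>Z\<^sub>i = \<lambda>(y\<^sub>i)\<close>, so that \<open>\<lambda>(r)\<close> defines the
  bracket \<open>{f, g} = \<Sum>\<^sub>i X\<^sub>i f \<sqdot> Z\<^sub>i g\<close> on local functions.

  The Jacobi identity for \<open>{_, _}\<close> is the classical Yang--Baxter equation, evaluated.  Since
  \<open>\<lambda>\<close> is an anti-homomorphism, a word \<open>a\<^sub>1 \<dots> a\<^sub>n\<close> over the Lie algebra acts on functions by
  applying \<open>\<lambda>(a\<^sub>1)\<close> first and \<open>\<lambda>(a\<^sub>n)\<close> last.  Given \<open>f, g, h\<close> and a point \<open>p\<close>, the map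
  \<open>w\<^sub>1 \<otimes> w\<^sub>2 \<otimes> w\<^sub>3 \<mapsto> (w\<^sub>1 f)(p) (w\<^sub>2 g)(p) (w\<^sub>3 h)(p)\<close> is therefore a well-defined linear functional on
  the third tensor power of the enveloping algebra (\<open>linear_extension_act_word_U3_ideal\<close>).  Its
  value on the Yang--Baxter element is an alternating sum of six expressions
  (\<open>classical_Yang_Baxter_act\<close>).  By the Leibniz rule \<open>{f, {g, h}}\<close> and \<open>{{f, g}, h}\<close> account for
  four of them up to an overall sign; the other two make up \<open>{g, {h, f}}\<close> once skewness of \<open>\<lambda>(r)\<close> has been applied to
  the pair of functions \<open>X\<^sub>j f, g\<close> (\<open>act2_jacobi\<close>).

  The compatibility of \<open>-\<lambda>(r)\<close> with the cobracket is the Leibniz rule again: the Lie derivative of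
  \<open>\<lambda>(r)\<close> along \<open>\<lambda>(x)\<close> brackets \<open>\<lambda>(x)\<close> into each leg, and \<open>[\<lambda>(x), \<lambda>(y)] = -\<lambda>([x, y])\<close> turns the
  result into \<open>-\<lambda>(ad\<^sub>x r)\<close>; the sign is the reason for passing to \<open>-\<lambda>(r)\<close>.

  Products and sums of smooth functions have to be known to be smooth before derivations can be
  applied to them, so the development starts with the algebra of smooth functions.
\<close>

section \<open>The algebra of smooth functions\<close>

text \<open>
  Partial derivatives in a direction \<open>i < n\<close> at a point of \<open>S\<close> only see values on \<open>S\<close>: moving the \<open>i\<close>-th
  coordinate does not leave the coordinate space, and \<open>S\<close> is open in it.
\<close>

lemma eventually_coordinate_line_in:
  fixes S :: "(nat \<Rightarrow> 'k::{real_normed_field,euclidean_space}) set"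
  assumes S: "openin (top_of_set (coord_space n)) S" and x: "x \<in> S" and i: "i < n"
  shows "\<forall>\<^sub>F t in nhds (x i). x(i := t) \<in> S"
proof -
  obtain T where T: "open T" "S = coord_space n \<inter> T"
    using S by (auto simp: openin_open)
  have cont: "continuous_on UNIV (\<lambda>t. x(i := t))"
  proof (rule continuous_on_coordinatewise_then_product)
    show "continuous_on UNIV (\<lambda>t. (x(i := t)) j)" for j
      by (cases "j = i") simp_all
  qed
  have "open ((\<lambda>t. x(i := t)) -` T)"
    using cont T(1) by (simp add: open_vimage)
  moreover have "x i \<in> (\<lambda>t. x(i := t)) -` T"
    using x T by simp
  ultimately have "\<forall>\<^sub>F t in nhds (x i). t \<in> (\<lambda>t. x(i := t)) -` T"
    by (rule eventually_nhds_in_open)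
  then show ?thesis
  proof eventually_elim
    case (elim t)
    have "x \<in> coord_space n"
      using x T by simp
    with i have "x(i := t) \<in> coord_space n"
      by (simp add: coord_space_def)
    with elim T show ?case
      by simp
  qed
qed

lemma partial_cong:
  assumes S: "openin (top_of_set (coord_space n)) S" and "x \<in> S" "i < n"
    and eq: "\<And>y. y \<in> S \<Longrightarrow> f y = g y"
  shows "partial i f x = partial i g x"
  unfolding partial_def
proof (rule deriv_cong_ev)
  show "\<forall>\<^sub>F t in nhds (x i). f (x(i := t)) = g (x(i := t))"
    using eventually_coordinate_line_in[OF assms(1-3)] by eventually_elim (rule eq)
qed simp

lemma partial_has_derivative:
  assumes "Ck_on n (Suc m) S f" "i < n" "x \<in> S"
  shows "((\<lambda>t. f (x(i := t))) has_field_derivative partial i f x) (at (x i))"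
  using assms by (simp add: partial_def DERIV_deriv_iff_field_differentiable)

lemma Ck_on_cong:
  assumes S: "openin (top_of_set (coord_space n)) S"
  shows "Ck_on n m S f \<Longrightarrow> (\<And>y. y \<in> S \<Longrightarrow> f y = g y) \<Longrightarrow> Ck_on n m S g"
proof (induction m arbitrary: f g)
  case 0
  then show ?case
    using continuous_on_cong by fastforce
next
  case (Suc m)
  have "continuous_on S g"
    using Suc.prems continuous_on_cong by fastforce
  moreover have "(\<lambda>t. g (x(i := t))) field_differentiable (at (x i))" if "i < n" "x \<in> S" for i x
  proof -
    have "((\<lambda>t. f (x(i := t))) has_field_derivative partial i f x) (at (x i))"
      using Suc.prems(1) that by (rule partial_has_derivative)
    moreover have "\<forall>\<^sub>F t in nhds (x i). f (x(i := t)) = g (x(i := t))"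
      using eventually_coordinate_line_in[OF S that(2,1)] by eventually_elim (rule Suc.prems(2))
    ultimately have "((\<lambda>t. g (x(i := t))) has_field_derivative partial i f x) (at (x i))"
      by (simp add: DERIV_cong_ev[of "x i" "x i"])
    then show ?thesis
      by (auto simp: field_differentiable_def)
  qed
  moreover have "Ck_on n m S (partial i g)" if "i < n" for i
  proof (rule Suc.IH)
    show "Ck_on n m S (partial i f)"
      using Suc.prems(1) that by simp
    show "partial i f y = partial i g y" if "y \<in> S" for y
      using partial_cong[OF S that \<open>i < n\<close>] Suc.prems(2) by blast
  qed
  ultimately show ?case
    by simp
qed

lemma Ck_on_Suc_imp: "Ck_on n (Suc m) S f \<Longrightarrow> Ck_on n m S f"
  by (induction m arbitrary: f) auto

lemma Ck_on_subset: "Ck_on n m S f \<Longrightarrow> T \<subseteq> S \<Longrightarrow> Ck_on n m T f"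
  by (induction m arbitrary: f) (auto intro: continuous_on_subset)

lemma Ck_on_const: "Ck_on n m S (\<lambda>_. c)"
proof (induction m arbitrary: c)
  case (Suc m)
  have "partial i (\<lambda>_. c) = (\<lambda>_. 0)" for i
    by (simp add: partial_def fun_eq_iff)
  with Suc show ?case
    by simp
qed simp

text \<open>
  The sum rule computes \<open>partial i (f + g)\<close> on \<open>S\<close> alone, hence the detour through
  \<open>Ck_on_cong\<close>; the same applies to products below.
\<close>

lemma Ck_on_add:
  assumes S: "openin (top_of_set (coord_space n)) S"
  shows "Ck_on n m S f \<Longrightarrow> Ck_on n m S g \<Longrightarrow> Ck_on n m S (\<lambda>x. f x + g x)"
proof (induction m arbitrary: f g)
  case 0
  then show ?case
    by (simp add: continuous_on_add)
next
  case (Suc m)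
  have d: "((\<lambda>t. f (x(i := t)) + g (x(i := t))) has_field_derivative partial i f x + partial i g x)
      (at (x i))" if "i < n" "x \<in> S" for i x
    using Suc.prems that by (intro DERIV_add partial_has_derivative)
  have "Ck_on n m S (partial i (\<lambda>x. f x + g x))" if "i < n" for i
  proof (rule Ck_on_cong[OF S])
    show "Ck_on n m S (\<lambda>x. partial i f x + partial i g x)"
      using Suc that by simp
    show "partial i f x + partial i g x = partial i (\<lambda>x. f x + g x) x" if "x \<in> S" for x
      using d[OF \<open>i < n\<close> that] by (simp add: partial_def DERIV_imp_deriv)
  qed
  with Suc.prems d show ?case
    by (auto simp: continuous_on_add field_differentiable_def)
qed

lemma Ck_on_mult:
  assumes S: "openin (top_of_set (coord_space n)) S"
  shows "Ck_on n m S f \<Longrightarrow> Ck_on n m S g \<Longrightarrow> Ck_on n m S (\<lambda>x. f x * g x)"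
proof (induction m arbitrary: f g)
  case 0
  then show ?case
    by (simp add: continuous_on_mult)
next
  case (Suc m)
  have d: "((\<lambda>t. f (x(i := t)) * g (x(i := t))) has_field_derivative
      partial i f x * g x + partial i g x * f x) (at (x i))" if "i < n" "x \<in> S" for i x
    using DERIV_mult[OF partial_has_derivative[OF Suc.prems(1) that]
        partial_has_derivative[OF Suc.prems(2) that]]
    by (simp only: fun_upd_triv)
  have "Ck_on n m S (partial i (\<lambda>x. f x * g x))" if "i < n" for i
  proof (rule Ck_on_cong[OF S])
    show "Ck_on n m S (\<lambda>x. partial i f x * g x + partial i g x * f x)"
      using Suc.prems[THEN Ck_on_Suc_imp] Suc.prems that by (intro Ck_on_add[OF S] Suc.IH) simp_all
    show "partial i f x * g x + partial i g x * f x = partial i (\<lambda>x. f x * g x) x" if "x \<in> S" for x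
      using d[OF \<open>i < n\<close> that] by (simp add: partial_def DERIV_imp_deriv)
  qed
  with Suc.prems d show ?case
    by (auto simp: continuous_on_mult field_differentiable_def)
qed

lemma openin_chart_image:
  assumes "manifold M" "(V, \<psi>) \<in> matlas M" "openin (mtop M) U"
  shows "openin (top_of_set (coord_space (mdim M))) (\<psi> ` (U \<inter> V))"
proof -
  have V: "openin (top_of_set (coord_space (mdim M))) (\<psi> ` V)"
    and h: "homeomorphic_map (subtopology (mtop M) V) (top_of_set (\<psi> ` V)) \<psi>"
    using assms(1,2) unfolding manifold_def by auto
  have "openin (subtopology (mtop M) V) (U \<inter> V)"
    using assms(3) by (auto simp: openin_subtopology)
  then have "openin (top_of_set (\<psi> ` V)) (\<psi> ` (U \<inter> V))"
    using homeomorphic_imp_open_map[OF h] unfolding open_map_def by blast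
  with V show ?thesis
    using openin_trans by blast
qed

lemma smooth_fun_const: "openin (mtop M) U \<Longrightarrow> smooth_fun M U (\<lambda>_. c)"
  by (simp add: smooth_fun_def smooth_on_def Ck_on_const case_prod_beta)

lemma smooth_fun_subset:
  assumes "smooth_fun M U f" "openin (mtop M) T" "T \<subseteq> U"
  shows "smooth_fun M T f"
proof -
  have "smooth_on (mdim M) (\<psi> ` (T \<inter> V)) (\<lambda>x. f (inv_into V \<psi> x))" if "(V, \<psi>) \<in> matlas M" for V \<psi>
  proof -
    have "\<psi> ` (T \<inter> V) \<subseteq> \<psi> ` (U \<inter> V)"
      using assms(3) by auto
    then show ?thesis
      using assms(1) that unfolding smooth_fun_def smooth_on_def by (fast intro: Ck_on_subset)
  qed
  with assms(2) show ?thesis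
    unfolding smooth_fun_def by auto
qed

lemma smooth_fun_add:
  assumes "manifold M" "smooth_fun M U f" "smooth_fun M U g"
  shows "smooth_fun M U (\<lambda>q. f q + g q)"
  using assms unfolding smooth_fun_def smooth_on_def
  by (force intro!: Ck_on_add openin_chart_image)

lemma smooth_fun_mult:
  assumes "manifold M" "smooth_fun M U f" "smooth_fun M U g"
  shows "smooth_fun M U (\<lambda>q. f q * g q)"
  using assms unfolding smooth_fun_def smooth_on_def
  by (force intro!: Ck_on_mult openin_chart_image)

lemma smooth_fun_sum:
  assumes "manifold M" "openin (mtop M) U" "\<And>i. i \<in> I \<Longrightarrow> smooth_fun M U (F i)"
  shows "smooth_fun M U (\<lambda>q. \<Sum>i\<in>I. F i q)"
  using assms(3)
  by (induction I rule: infinite_finite_induct)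
    (simp_all add: smooth_fun_const smooth_fun_add assms(1,2))

lemma smooth_nearI: "smooth_fun M U f \<Longrightarrow> p \<in> U \<Longrightarrow> smooth_near M p f"
  by (auto simp: smooth_near_def)

text \<open>
  Lets two germs at \<open>p\<close> be handled as functions that are smooth on one and the same open set.
\<close>

lemma smooth_near_common:
  assumes "smooth_near M p f" "smooth_near M p g"
  obtains U where "p \<in> U" "smooth_fun M U f" "smooth_fun M U g"
proof -
  obtain U V where "p \<in> U" "smooth_fun M U f" "p \<in> V" "smooth_fun M V g"
    using assms by (auto simp: smooth_near_def)
  moreover from this have "openin (mtop M) (U \<inter> V)"
    by (auto simp: smooth_fun_def)
  ultimately have "p \<in> U \<inter> V" "smooth_fun M (U \<inter> V) f" "smooth_fun M (U \<inter> V) g"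
    by (auto intro: smooth_fun_subset)
  then show ?thesis
    by (rule that)
qed

section \<open>Linear functionals on monoid algebras\<close>

definition linear_extension :: "('m \<Rightarrow> 'k) \<Rightarrow> ('m \<Rightarrow>\<^sub>0 'k::comm_ring_1) \<Rightarrow> 'k" where
  "linear_extension c u = (\<Sum>k\<in>Poly_Mapping.keys u. Poly_Mapping.lookup u k * c k)"

lemma linear_extension_superset:
  assumes "finite K" "Poly_Mapping.keys u \<subseteq> K"
  shows "linear_extension c u = (\<Sum>k\<in>K. Poly_Mapping.lookup u k * c k)"
  unfolding linear_extension_def
  using assms by (intro sum.mono_neutral_left) (auto simp: in_keys_iff)

lemma linear_extension_zero [simp]: "linear_extension c 0 = 0"
  by (simp add: linear_extension_def)

lemma linear_extension_single [simp]: "linear_extension c (Poly_Mapping.single k s) = s * c k"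
  by (simp add: linear_extension_def)

lemma linear_extension_add [simp]:
  "linear_extension c (u + v) = linear_extension c u + linear_extension c v"
proof -
  let ?K = "Poly_Mapping.keys u \<union> Poly_Mapping.keys v"
  have "linear_extension c (u + v) = (\<Sum>k\<in>?K. Poly_Mapping.lookup (u + v) k * c k)"
    by (intro linear_extension_superset keys_add) simp
  also have "\<dots> = linear_extension c u + linear_extension c v"
    by (simp add: linear_extension_superset[of ?K] lookup_add distrib_right sum.distrib)
  finally show ?thesis .
qed

lemma linear_extension_diff [simp]:
  "linear_extension c (u - v) = linear_extension c u - linear_extension c v"
  using linear_extension_add[of c "u - v" v] by (simp add: algebra_simps)

lemma linear_extension_sum:
  "linear_extension c (\<Sum>i\<in>I. u i) = (\<Sum>i\<in>I. linear_extension c (u i))"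
  by (induction I rule: infinite_finite_induct) simp_all

lemma poly_mapping_single_add_induct [case_names single add]:
  assumes single: "\<And>k s. P (Poly_Mapping.single k s)"
    and add: "\<And>u v. P u \<Longrightarrow> P v \<Longrightarrow> P (u + v)"
  shows "P (u :: 'm \<Rightarrow>\<^sub>0 'k::comm_monoid_add)"
proof -
  have zero: "P 0"
    using single[of undefined 0] by simp
  show ?thesis
  proof (induction u rule: update_induct)
    case const
    show ?case
      by (rule zero)
  next
    case (update u k s)
    have "Poly_Mapping.update k s u = u + Poly_Mapping.single k s"
      using update(1)
      by (intro poly_mapping_eqI)
        (auto simp: lookup_update lookup_add lookup_single in_keys_iff when_def)
    with update show ?case
      by (simp add: add single)
  qed
qed

text \<open>
  The two-sided ideal is spanned by its generators multiplied by monomials \<open>m\<close>, \<open>n\<close> on both sides.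
  So a functional given by its values \<open>c\<close> on monomials descends to the quotient as soon as \<open>c\<close>
  respects each defining relation inside an arbitrary context \<open>m + _ + n\<close>.
\<close>

lemma linear_extension_U3_ideal:
  fixes smul :: "'k::field \<Rightarrow> 'g::ab_group_add \<Rightarrow> 'g" and c :: "'g words3 \<Rightarrow> 'k"
  assumes add: "\<And>e x y m n. e \<in> slots \<Longrightarrow>
      c (m + e [x + y] + n) = c (m + e [x] + n) + c (m + e [y] + n)"
    and scale: "\<And>e s x m n. e \<in> slots \<Longrightarrow> c (m + e [smul s x] + n) = s * c (m + e [x] + n)"
    and brk: "\<And>e x y m n. e \<in> slots \<Longrightarrow>
      c (m + e [bracket x y] + n) = c (m + e [x, y] + n) - c (m + e [y, x] + n)"
    and u: "u \<in> U3_ideal smul bracket"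
  shows "linear_extension c u = 0"
proof -
  have ext: "linear_extension c (a * v * b) = 0"
    if mono: "\<And>m s n t. linear_extension c (Poly_Mapping.single m s * v * Poly_Mapping.single n t) = 0"
    for v a b
  proof (induction a rule: poly_mapping_single_add_induct)
    case (single m s)
    show ?case
      by (induction b rule: poly_mapping_single_add_induct) (simp_all add: mono distrib_left)
  qed (simp add: distrib_right)
  have "linear_extension c (a * u * b) = 0" for a b
    using u
  proof (induction arbitrary: a b)
    case (mult u a' b')
    from mult.IH[of "a * a'" "b' * b"] show ?case
      by (simp add: mult.assoc)
  next
    case (rel_add e x y)
    show ?case
      by (rule ext) (simp add: left_diff_distrib right_diff_distrib mult_single add[OF rel_add] distrib_left)
  next
    case (rel_scale e s x)
    show ?case
      by (rule ext) (simp add: left_diff_distrib right_diff_distrib mult_single scale[OF rel_scale])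
  next
    case (rel_bracket e x y)
    show ?case
      by (rule ext) (simp add: left_diff_distrib right_diff_distrib mult_single brk[OF rel_bracket])
  qed (simp_all add: distrib_left distrib_right)
  from this[of 1 1] show ?thesis
    by simp
qed

section \<open>Derivations at a point\<close>

lemma tangent_add:
  "v \<in> tangent_space M p \<Longrightarrow> smooth_near M p f \<Longrightarrow> smooth_near M p g \<Longrightarrow>
    v (\<lambda>q. f q + g q) = v f + v g"
  by (simp add: tangent_space_def)

lemma tangent_mult:
  "v \<in> tangent_space M p \<Longrightarrow> smooth_near M p f \<Longrightarrow> smooth_near M p g \<Longrightarrow>
    v (\<lambda>q. f q * g q) = f p * v g + g p * v f"
  by (simp add: tangent_space_def)

lemma tangent_scale:
  "v \<in> tangent_space M p \<Longrightarrow> smooth_near M p f \<Longrightarrow> v (\<lambda>q. c * f q) = c * v f"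
  by (simp add: tangent_space_def)

lemma tangent_uminus:
  "v \<in> tangent_space M p \<Longrightarrow> smooth_near M p f \<Longrightarrow> v (\<lambda>q. - f q) = - v f"
  using tangent_scale[of v M p f "-1"] by simp

lemma tangent_not_smooth: "v \<in> tangent_space M p \<Longrightarrow> \<not> smooth_near M p f \<Longrightarrow> v f = 0"
  by (simp add: tangent_space_def)

lemma tangent_germ:
  assumes "v \<in> tangent_space M p"
  shows "\<forall>f g U. smooth_near M p f \<longrightarrow> smooth_near M p g \<longrightarrow>
    openin (mtop M) U \<longrightarrow> p \<in> U \<longrightarrow> (\<forall>q\<in>U. f q = g q) \<longrightarrow> v f = v g"
  using assms unfolding tangent_space_def mem_Collect_eq by (elim conjE)

lemma tangent_local:
  assumes "v \<in> tangent_space M p" "smooth_fun M U f" "smooth_fun M U g" "p \<in> U"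
    and "\<And>q. q \<in> U \<Longrightarrow> f q = g q"
  shows "v f = v g"
proof -
  have "smooth_near M p f" "smooth_near M p g" "openin (mtop M) U"
    using assms(2-4) by (auto simp: smooth_fun_def intro: smooth_nearI)
  with tangent_germ[OF assms(1)] show ?thesis
    using assms(4,5) by metis
qed

lemma tangent_sum:
  assumes M: "manifold M" and v: "v \<in> tangent_space M p" and p: "p \<in> U" "openin (mtop M) U"
    and F: "\<And>i. i \<in> I \<Longrightarrow> smooth_fun M U (F i)"
  shows "v (\<lambda>q. \<Sum>i\<in>I. F i q) = (\<Sum>i\<in>I. v (F i))"
proof -
  have zero: "v (\<lambda>_. 0) = 0"
    using tangent_scale[OF v smooth_nearI[OF smooth_fun_const[OF p(2)] p(1)], of 0 0] by simp
  show ?thesis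
    using F
  proof (induction I rule: infinite_finite_induct)
    case (insert i I)
    have "smooth_near M p (F i)" "smooth_near M p (\<lambda>q. \<Sum>i\<in>I. F i q)"
      using insert.prems by (auto intro!: smooth_nearI[OF _ p(1)] smooth_fun_sum[OF M p(2)])
    with insert show ?case
      by (simp add: tangent_add[OF v])
  qed (simp_all add: zero)
qed

text \<open>
  Combines linearity with locality: \<open>h\<close> need only agree with the linear combination on \<open>U\<close>.  This
  matters because a bracket of vector fields is the commutator of derivations only on functions
  that are smooth at the point in question.
\<close>

lemma tangent_linear_on:
  assumes M: "manifold M" and v: "v \<in> tangent_space M p" and p: "p \<in> U"
    and s: "smooth_fun M U f" "smooth_fun M U g" "smooth_fun M U h"
    and eq: "\<And>q. q \<in> U \<Longrightarrow> h q = a * f q + b * g q"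
  shows "v h = a * v f + b * v g"
proof -
  have U: "openin (mtop M) U"
    using s(1) by (simp add: smooth_fun_def)
  have af: "smooth_fun M U (\<lambda>q. a * f q)" and bg: "smooth_fun M U (\<lambda>q. b * g q)"
    using s by (auto intro!: smooth_fun_mult[OF M] smooth_fun_const U)
  have "v h = v (\<lambda>q. a * f q + b * g q)"
    using v s(3) smooth_fun_add[OF M af bg] p eq by (rule tangent_local)
  also have "\<dots> = a * v f + b * v g"
    using af bg s p by (simp add: tangent_add[OF v] tangent_scale[OF v] smooth_nearI)
  finally show ?thesis .
qed

section \<open>Words over the Lie algebra as differential operators\<close>

lemma vector_field_tangent: "vector_field M X \<Longrightarrow> X p \<in> tangent_space M p"
  by (simp add: vector_field_def)

lemma vector_field_smooth: "vector_field M X \<Longrightarrow> smooth_fun M U f \<Longrightarrow> smooth_fun M U (\<lambda>q. X q f)"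
  by (simp add: vector_field_def)

text \<open>
  The leftmost letter acts first, as an anti-homomorphism requires.
\<close>

definition act_word :: "('g \<Rightarrow> ('a, 'k) vfield) \<Rightarrow> 'g list \<Rightarrow> ('a \<Rightarrow> 'k) \<Rightarrow> 'a \<Rightarrow> 'k" where
  "act_word lam w f = fold (\<lambda>x F q. lam x q F) w f"

lemma act_word_Nil [simp]: "act_word lam [] f = f"
  and act_word_Cons [simp]: "act_word lam (x # w) f = act_word lam w (\<lambda>q. lam x q f)"
  and act_word_append: "act_word lam (w @ w') f = act_word lam w' (act_word lam w f)"
  by (simp_all add: act_word_def)

lemma smooth_fun_act_word:
  assumes "\<And>x. vector_field M (lam x)" "smooth_fun M U f"
  shows "smooth_fun M U (act_word lam w f)"
  using assms(2)
proof (induction w arbitrary: f)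
  case (Cons x w)
  have "smooth_fun M U (\<lambda>q. lam x q f)"
    using assms(1) Cons.prems by (rule vector_field_smooth)
  then show ?case
    by (simp add: Cons.IH)
qed simp

lemma act_word_linear_on:
  assumes M: "manifold M" and vf: "\<And>x. vector_field M (lam x)"
    and "smooth_fun M U f" "smooth_fun M U g" "smooth_fun M U h"
    and "\<And>q. q \<in> U \<Longrightarrow> h q = a * f q + b * g q"
    and p: "p \<in> U"
  shows "act_word lam w h p = a * act_word lam w f p + b * act_word lam w g p"
  using assms(3-6)
proof (induction w arbitrary: f g h)
  case Nil
  with p show ?case
    by simp
next
  case (Cons x w)
  have "lam x q h = a * lam x q f + b * lam x q g" if "q \<in> U" for q
    by (rule tangent_linear_on[OF M vector_field_tangent[OF vf] that Cons.prems(1-3)])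
      (rule Cons.prems(4))
  then have "act_word lam w (\<lambda>q. lam x q h) p =
      a * act_word lam w (\<lambda>q. lam x q f) p + b * act_word lam w (\<lambda>q. lam x q g) p"
    using Cons.prems(1-3) by (intro Cons.IH vector_field_smooth[OF vf])
  then show ?case
    by simp
qed

text \<open>
  These are the defining relations of the enveloping algebra inside a word \<open>w _ w'\<close>.  The prefix \<open>w\<close>
  replaces \<open>f\<close> by another smooth function, on which the relation holds because \<open>lam\<close> is an action;
  the suffix \<open>w'\<close> preserves it by \<open>act_word_linear_on\<close>.
\<close>

lemma
  assumes M: "manifold M" and act: "left_action smul bracket M lam"
    and f: "smooth_fun M U f" and p: "p \<in> U"
  shows act_word_add_letter:
      "act_word lam (w @ (x + y) # w') f p = act_word lam (w @ x # w') f p + act_word lam (w @ y # w') f p"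
    and act_word_scale_letter:
      "act_word lam (w @ smul s x # w') f p = s * act_word lam (w @ x # w') f p"
    and act_word_bracket_letter:
      "act_word lam (w @ bracket x y # w') f p =
        act_word lam (w @ x # y # w') f p - act_word lam (w @ y # x # w') f p"
proof -
  have vf: "\<And>x. vector_field M (lam x)"
    using act by (simp add: left_action_def)
  let ?F = "act_word lam w f"
  have F: "smooth_fun M U ?F"
    by (rule smooth_fun_act_word[OF vf f])
  note lin = act_word_linear_on[where lam = lam, OF M vf _ _ _ _ p]
  note sm = vector_field_smooth[OF vf] F
  have "act_word lam w' (\<lambda>q. lam (x + y) q ?F) p =
      1 * act_word lam w' (\<lambda>q. lam x q ?F) p + 1 * act_word lam w' (\<lambda>q. lam y q ?F) p"
    using act by (intro lin sm) (simp add: left_action_def)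
  then show "act_word lam (w @ (x + y) # w') f p =
      act_word lam (w @ x # w') f p + act_word lam (w @ y # w') f p"
    by (simp add: act_word_append)
  have "act_word lam w' (\<lambda>q. lam (smul s x) q ?F) p =
      s * act_word lam w' (\<lambda>q. lam x q ?F) p + 0 * act_word lam w' (\<lambda>q. lam x q ?F) p"
    using act by (intro lin sm) (simp add: left_action_def)
  then show "act_word lam (w @ smul s x # w') f p = s * act_word lam (w @ x # w') f p"
    by (simp add: act_word_append)
  have "act_word lam w' (\<lambda>q. lam (bracket x y) q ?F) p =
      1 * act_word lam w' (\<lambda>q. lam y q (\<lambda>q. lam x q ?F)) p +
      (- 1) * act_word lam w' (\<lambda>q. lam x q (\<lambda>q. lam y q ?F)) p"
  proof (intro lin sm)
    fix q assume "q \<in> U"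
    then have "smooth_near M q ?F"
      using F by (rule smooth_nearI[rotated])
    with act show "lam (bracket x y) q ?F =
        1 * lam y q (\<lambda>q. lam x q ?F) + (- 1) * lam x q (\<lambda>q. lam y q ?F)"
      by (simp add: left_action_def vf_bracket_def)
  qed
  then show "act_word lam (w @ bracket x y # w') f p =
      act_word lam (w @ x # y # w') f p - act_word lam (w @ y # x # w') f p"
    by (simp add: act_word_append)
qed

text \<open>
  A slot map changes one of the three words and leaves the other two alone, so each relation reduces
  to the one for a single word.
\<close>

lemma linear_extension_act_word_U3_ideal:
  fixes lam :: "'g::ab_group_add \<Rightarrow> ('a, 'k::{real_normed_field,euclidean_space}) vfield"
  assumes M: "manifold M" and act: "left_action smul bracket M lam"
    and f: "smooth_fun M U f" and g: "smooth_fun M U g" and h: "smooth_fun M U h" and p: "p \<in> U"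
    and u: "u \<in> U3_ideal smul bracket"
  shows "linear_extension (\<lambda>(w1, w2, w3). act_word lam w1 f p * act_word lam w2 g p * act_word lam w3 h p) u = 0"
    (is "linear_extension ?c u = 0")
  using _ _ _ u
proof (rule linear_extension_U3_ideal)
  fix e :: "'g list \<Rightarrow> 'g words3" and x y s and m n :: "'g words3"
  assume e: "e \<in> slots"
  obtain m1 m2 m3 n1 n2 n3 where mn: "m = (m1, m2, m3)" "n = (n1, n2, n3)"
    by (metis prod_cases3)
  note letter = f[THEN act_word_add_letter[OF M act _ p]] g[THEN act_word_add_letter[OF M act _ p]]
    h[THEN act_word_add_letter[OF M act _ p]] f[THEN act_word_scale_letter[OF M act _ p]]
    g[THEN act_word_scale_letter[OF M act _ p]] h[THEN act_word_scale_letter[OF M act _ p]]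
    f[THEN act_word_bracket_letter[OF M act _ p]] g[THEN act_word_bracket_letter[OF M act _ p]]
    h[THEN act_word_bracket_letter[OF M act _ p]]
  show "?c (m + e [x + y] + n) = ?c (m + e [x] + n) + ?c (m + e [y] + n)"
    and "?c (m + e [smul s x] + n) = s * ?c (m + e [x] + n)"
    and "?c (m + e [bracket x y] + n) = ?c (m + e [x, y] + n) - ?c (m + e [y, x] + n)"
    using e by (auto simp: slots_def mn plus_list_def letter algebra_simps)
qed

section \<open>The Jacobi identity\<close>

lemma linear_extension_commutator:
  fixes c :: "'m::monoid_add \<Rightarrow> 'k::comm_ring_1"
  shows "linear_extension c (commutator (\<Sum>i\<in>I. Poly_Mapping.single (k i) 1)
      (\<Sum>j\<in>J. Poly_Mapping.single (l j) 1)) = (\<Sum>i\<in>I. \<Sum>j\<in>J. c (k i + l j) - c (l j + k i))"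
proof -
  have "linear_extension c (commutator (\<Sum>i\<in>I. Poly_Mapping.single (k i) 1)
      (\<Sum>j\<in>J. Poly_Mapping.single (l j) 1)) =
      (\<Sum>i\<in>I. \<Sum>j\<in>J. c (k i + l j)) - (\<Sum>j\<in>J. \<Sum>i\<in>I. c (l j + k i))"
    by (simp add: commutator_def sum_product mult_single linear_extension_sum)
  also have "\<dots> = (\<Sum>i\<in>I. \<Sum>j\<in>J. c (k i + l j) - c (l j + k i))"
    by (subst (2) sum.swap) (simp add: sum_subtractf)
  finally show ?thesis .
qed

lemma sum_list_pairs_nth:
  "(\<Sum>(x, y)\<leftarrow>r. F x y) = (\<Sum>i<length r. F (fst (r ! i)) (snd (r ! i)))"
  by (simp add: sum_list_sum_nth atLeast0LessThan case_prod_beta)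

lemma act2_nth: "act2 lam r p f g = (\<Sum>i<length r. lam (fst (r ! i)) p f * lam (snd (r ! i)) p g)"
  by (simp add: act2_def sum_list_pairs_nth)

text \<open>
  The three lines are the values of the functional on the commutators of \<open>r\<^sub>1\<^sub>2, r\<^sub>1\<^sub>3\<close>, of \<open>r\<^sub>1\<^sub>2, r\<^sub>2\<^sub>3\<close> and
  of \<open>r\<^sub>1\<^sub>3, r\<^sub>2\<^sub>3\<close>.  In the first, for instance, \<open>x\<^sub>i x\<^sub>j \<otimes> y\<^sub>i \<otimes> y\<^sub>j\<close> acts on \<open>f\<close> through \<open>X\<^sub>j X\<^sub>i\<close>, in reversed
  order.
\<close>

lemma classical_Yang_Baxter_act:
  fixes lam :: "'g::ab_group_add \<Rightarrow> ('a, 'k::{real_normed_field,euclidean_space}) vfield"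
  assumes M: "manifold M" and act: "left_action smul bracket M lam"
    and qt: "quasitriangular smul bracket r"
    and f: "smooth_fun M U f" and g: "smooth_fun M U g" and h: "smooth_fun M U h" and p: "p \<in> U"
  defines "X \<equiv> \<lambda>i. lam (fst (r ! i))" and "Z \<equiv> \<lambda>i. lam (snd (r ! i))" and "I \<equiv> {..<length r}"
  shows "(\<Sum>i\<in>I. \<Sum>j\<in>I. X j p (\<lambda>q. X i q f) * Z i p g * Z j p h - X i p (\<lambda>q. X j q f) * Z i p g * Z j p h) +
    (\<Sum>i\<in>I. \<Sum>j\<in>I. X i p f * X j p (\<lambda>q. Z i q g) * Z j p h - X i p f * Z i p (\<lambda>q. X j q g) * Z j p h) +
    (\<Sum>i\<in>I. \<Sum>j\<in>I. X i p f * X j p g * Z j p (\<lambda>q. Z i q h) - X i p f * X j p g * Z i p (\<lambda>q. Z j q h)) = 0"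
proof -
  have "commutator (r12 r) (r13 r) + commutator (r12 r) (r23 r) + commutator (r13 r) (r23 r)
      \<in> U3_ideal smul bracket"
    using qt by (simp add: quasitriangular_def)
  from linear_extension_act_word_U3_ideal[OF M act f g h p this] show ?thesis
    by (simp add: r12_def r13_def r23_def sum_list_pairs_nth linear_extension_commutator
        plus_list_def X_def Z_def I_def)
qed

text \<open>
  The Leibniz rule for the bracket of functions defined by \<open>r\<close>.
\<close>

lemma tangent_act2:
  assumes M: "manifold M" and vf: "\<And>x. vector_field M (lam x)" and v: "v \<in> tangent_space M p"
    and f: "smooth_near M p f" and g: "smooth_near M p g"
  shows "v (\<lambda>q. act2 lam r q f g) = (\<Sum>i<length r.
    lam (fst (r ! i)) p f * v (\<lambda>q. lam (snd (r ! i)) q g) +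
    v (\<lambda>q. lam (fst (r ! i)) q f) * lam (snd (r ! i)) p g)"
proof -
  obtain U where U: "p \<in> U" "smooth_fun M U f" "smooth_fun M U g"
    using f g by (rule smooth_near_common)
  have op: "openin (mtop M) U"
    using U by (simp add: smooth_fun_def)
  have lf: "smooth_fun M U (\<lambda>q. lam x q f)" and lg: "smooth_fun M U (\<lambda>q. lam x q g)" for x
    using U by (auto intro: vector_field_smooth[OF vf])
  have "v (\<lambda>q. act2 lam r q f g) =
      (\<Sum>i<length r. v (\<lambda>q. lam (fst (r ! i)) q f * lam (snd (r ! i)) q g))"
    unfolding act2_nth by (intro tangent_sum[OF M v U(1) op] smooth_fun_mult[OF M] lf lg)
  then show ?thesis
    by (simp add: tangent_mult[OF v smooth_nearI[OF lf U(1)] smooth_nearI[OF lg U(1)]] mult.commute)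
qed

lemma tensor_field_act2:
  assumes M: "manifold M" and vf: "\<And>x. vector_field M (lam x)"
  shows "tensor_field M (act2 lam r)"
  unfolding tensor_field_def
proof (intro conjI allI impI)
  fix p
  let ?vs = "map (\<lambda>(x, y). (lam x p, lam y p)) r"
  have "set ?vs \<subseteq> tangent_space M p \<times> tangent_space M p"
    using vector_field_tangent[OF vf] by auto
  moreover have "act2 lam r p = (\<lambda>f g. \<Sum>(v, w)\<leftarrow>?vs. v f * w g)"
    by (simp add: act2_def comp_def case_prod_unfold)
  ultimately show "act2 lam r p \<in> tangent_space2 M p"
    unfolding tangent_space2_def by blast
next
  fix U f g assume fg: "smooth_fun M U f" "smooth_fun M U g"
  then have "openin (mtop M) U"
    by (simp add: smooth_fun_def)
  with fg show "smooth_fun M U (\<lambda>p. act2 lam r p f g)"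
    unfolding act2_nth by (intro smooth_fun_sum[OF M] smooth_fun_mult[OF M] vector_field_smooth[OF vf])
qed

lemma tangent_space_uminus:
  assumes v: "v \<in> tangent_space M p"
  shows "(\<lambda>f. - v f) \<in> tangent_space M p"
proof -
  have "\<forall>f g U. smooth_near M p f \<longrightarrow> smooth_near M p g \<longrightarrow>
      openin (mtop M) U \<longrightarrow> p \<in> U \<longrightarrow> (\<forall>q\<in>U. f q = g q) \<longrightarrow> - v f = - v g"
    using tangent_germ[OF v] by (simp only: neg_equal_iff_equal)
  then show ?thesis
    unfolding tangent_space_def mem_Collect_eq
    by (intro conjI; (assumption |
        simp (no_asm) add: tangent_add[OF v] tangent_mult[OF v] tangent_scale[OF v] tangent_not_smooth[OF v]))
qed

lemma tensor_field_neg: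
  assumes M: "manifold M" and B: "tensor_field M B"
  shows "tensor_field M (neg_field B)"
  unfolding tensor_field_def
proof (intro conjI allI impI)
  fix p
  obtain vs where vs: "set vs \<subseteq> tangent_space M p \<times> tangent_space M p"
    "B p = (\<lambda>f g. \<Sum>(v, w)\<leftarrow>vs. v f * w g)"
    using B unfolding tensor_field_def tangent_space2_def by blast
  let ?vs = "map (\<lambda>(v, w). (\<lambda>f. - v f, w)) vs"
  have "set ?vs \<subseteq> tangent_space M p \<times> tangent_space M p"
    using vs(1) by (auto intro: tangent_space_uminus)
  moreover have "neg_field B p = (\<lambda>f g. \<Sum>(v, w)\<leftarrow>?vs. v f * w g)"
    by (simp add: neg_field_def vs(2) comp_def case_prod_beta uminus_sum_list_map)
  ultimately show "neg_field B p \<in> tangent_space2 M p"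
    unfolding tangent_space2_def by blast
next
  fix U f g assume fg: "smooth_fun M U f" "smooth_fun M U g"
  have "openin (mtop M) U"
    using fg by (simp add: smooth_fun_def)
  then have "smooth_fun M U (\<lambda>_. - 1)"
    by (rule smooth_fun_const)
  moreover have "smooth_fun M U (\<lambda>p. B p f g)"
    using B fg by (simp add: tensor_field_def)
  ultimately have "smooth_fun M U (\<lambda>p. - 1 * B p f g)"
    by (rule smooth_fun_mult[OF M])
  then show "smooth_fun M U (\<lambda>p. neg_field B p f g)"
    by (simp add: neg_field_def)
qed

lemma tensor_field_smooth_near:
  assumes B: "tensor_field M B" and "smooth_near M p f" "smooth_near M p g"
  shows "smooth_near M p (\<lambda>q. B q f g)"
proof -
  obtain U where U: "p \<in> U" "smooth_fun M U f" "smooth_fun M U g"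
    using assms(2,3) by (rule smooth_near_common)
  then have "smooth_fun M U (\<lambda>q. B q f g)"
    using B by (simp add: tensor_field_def)
  then show ?thesis
    using U(1) by (rule smooth_nearI)
qed

lemma tangent2_uminus_right:
  assumes "b \<in> tangent_space2 M p" "smooth_near M p g"
  shows "b f (\<lambda>q. - g q) = - b f g"
proof -
  obtain vs where vs: "set vs \<subseteq> tangent_space M p \<times> tangent_space M p"
    "b = (\<lambda>f g. \<Sum>(v, w)\<leftarrow>vs. v f * w g)"
    using assms(1) unfolding tangent_space2_def by blast
  have "v f * w (\<lambda>q. - g q) = - (v f * w g)" if "(v, w) \<in> set vs" for v w
    using that vs(1) assms(2) by (auto simp: tangent_uminus)
  then have "map (\<lambda>(v, w). v f * w (\<lambda>q. - g q)) vs = map (\<lambda>x. - (case x of (v, w) \<Rightarrow> v f * w g)) vs"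
    by auto
  then show ?thesis
    by (simp only: vs(2) uminus_sum_list_map comp_def)
qed

text \<open>
  With the six double sums named as in the proof, the Yang--Baxter equation says
  \<open>A1 - A2 + B1 - B2 + C1 - C2 = 0\<close>, while the three cyclic terms are \<open>B2 + C2\<close>, \<open>A2 - C1\<close> and
  \<open>- (A1 + B1)\<close>.
\<close>

lemma act2_jacobi:
  fixes lam :: "'g::ab_group_add \<Rightarrow> ('a, 'k::{real_normed_field,euclidean_space}) vfield"
  assumes M: "manifold M" and act: "left_action smul bracket M lam"
    and qt: "quasitriangular smul bracket r"
    and skew: "skew_symmetric (act2 lam r)"
    and f: "smooth_near M p f" and g: "smooth_near M p g" and h: "smooth_near M p h"
  shows "act2 lam r p f (\<lambda>q. act2 lam r q g h) + act2 lam r p g (\<lambda>q. act2 lam r q h f) +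
    act2 lam r p h (\<lambda>q. act2 lam r q f g) = 0"
proof -
  have vf: "\<And>x. vector_field M (lam x)"
    using act by (simp add: left_action_def)
  note leibniz = tangent_act2[where lam = lam and r = r, OF M vf vector_field_tangent[OF vf]]
  obtain U where U: "p \<in> U" "smooth_fun M U f" "smooth_fun M U g"
    using f g by (rule smooth_near_common)
  obtain V where V: "p \<in> V" "smooth_fun M V h"
    using h by (auto simp: smooth_near_def)
  have UV: "openin (mtop M) (U \<inter> V)"
    using U(2) V(2) by (simp add: smooth_fun_def openin_Int)
  note sm = smooth_fun_subset[OF U(2) UV Int_lower1] smooth_fun_subset[OF U(3) UV Int_lower1]
    smooth_fun_subset[OF V(2) UV Int_lower2] IntI[OF U(1) V(1)]
  have tens: "tensor_field M (act2 lam r)"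
    by (rule tensor_field_act2[OF M vf])
  define I where "I = {..<length r}"
  define X where "X i = lam (fst (r ! i))" for i
  define Z where "Z i = lam (snd (r ! i))" for i
  have swap: "act2 lam r q u w = - act2 lam r q w u" for q u w
    using skew unfolding skew_symmetric_def by (elim allE)
  define A1 where "A1 = (\<Sum>i\<in>I. \<Sum>j\<in>I. X j p (\<lambda>q. X i q f) * Z i p g * Z j p h)"
  define A2 where "A2 = (\<Sum>i\<in>I. \<Sum>j\<in>I. X i p (\<lambda>q. X j q f) * Z i p g * Z j p h)"
  define B1 where "B1 = (\<Sum>i\<in>I. \<Sum>j\<in>I. X i p f * X j p (\<lambda>q. Z i q g) * Z j p h)"
  define B2 where "B2 = (\<Sum>i\<in>I. \<Sum>j\<in>I. X i p f * Z i p (\<lambda>q. X j q g) * Z j p h)"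
  define C1 where "C1 = (\<Sum>i\<in>I. \<Sum>j\<in>I. X i p f * X j p g * Z j p (\<lambda>q. Z i q h))"
  define C2 where "C2 = (\<Sum>i\<in>I. \<Sum>j\<in>I. X i p f * X j p g * Z i p (\<lambda>q. Z j q h))"
  have cybe: "A1 - A2 + (B1 - B2) + (C1 - C2) = 0"
    using classical_Yang_Baxter_act[OF M act qt sm]
    by (simp add: A1_def A2_def B1_def B2_def C1_def C2_def X_def Z_def I_def sum_subtractf)
  have T1: "act2 lam r p f (\<lambda>q. act2 lam r q g h) = B2 + C2"
    by (subst act2_nth[of _ _ p f])
      (simp add: leibniz g h B2_def C2_def X_def Z_def I_def sum_distrib_left sum.distrib algebra_simps)
  have "act2 lam r p (\<lambda>q. act2 lam r q f g) h =
      (\<Sum>j\<in>I. \<Sum>i\<in>I. X j p (\<lambda>q. X i q f) * Z i p g * Z j p h + X i p f * X j p (\<lambda>q. Z i q g) * Z j p h)"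
    by (subst act2_nth[of _ _ p _ h])
      (simp add: leibniz f g X_def Z_def I_def sum_distrib_left algebra_simps)
  also have "\<dots> = A1 + B1"
    unfolding A1_def B1_def by (subst sum.swap) (simp add: sum.distrib)
  finally have T3: "act2 lam r p h (\<lambda>q. act2 lam r q f g) = - (A1 + B1)"
    using swap[of p h] by simp
  \<comment> \<open>For fixed \<open>j\<close> the sum over \<open>i\<close> is the bracket of \<open>X j f\<close> and \<open>g\<close>.  Exchanging these two
     moves the second derivative of \<open>f\<close> from the form \<open>X X f\<close> to \<open>Z X f\<close>, which is the one that the
     Leibniz rule produces in the middle cyclic term.\<close>
  have A2: "A2 = - (\<Sum>j\<in>I. \<Sum>i\<in>I. X i p g * Z i p (\<lambda>q. X j q f) * Z j p h)"
  proof -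
    have "A2 = (\<Sum>j\<in>I. act2 lam r p (\<lambda>q. X j q f) g * Z j p h)"
      unfolding A2_def by (subst sum.swap) (simp add: act2_nth X_def Z_def I_def sum_distrib_right)
    also have "\<dots> = - (\<Sum>j\<in>I. act2 lam r p g (\<lambda>q. X j q f) * Z j p h)"
      by (simp add: swap[of p _ g] sum_negf)
    finally show ?thesis
      by (simp add: act2_nth X_def Z_def I_def sum_distrib_right)
  qed
  have "act2 lam r p g (\<lambda>q. act2 lam r q h f) = act2 lam r p g (\<lambda>q. - act2 lam r q f h)"
    by (simp add: swap[of _ h f])
  also have "\<dots> = - act2 lam r p g (\<lambda>q. act2 lam r q f h)"
  proof (rule tangent2_uminus_right[of "act2 lam r p" M p "\<lambda>q. act2 lam r q f h" g])
    show "act2 lam r p \<in> tangent_space2 M p"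
      using tens by (simp add: tensor_field_def)
    show "smooth_near M p (\<lambda>q. act2 lam r q f h)"
      using tens f h by (rule tensor_field_smooth_near)
  qed
  also have "\<dots> = - (\<Sum>j\<in>I. \<Sum>i\<in>I.
      X j p g * Z j p (\<lambda>q. X i q f) * Z i p h + X i p f * X j p g * Z j p (\<lambda>q. Z i q h))"
    by (subst act2_nth[of _ _ p g])
      (simp add: leibniz f h X_def Z_def I_def sum_distrib_left algebra_simps)
  also have "\<dots> = A2 - C1"
    unfolding A2 C1_def by (subst sum.swap) (simp add: sum.distrib)
  finally have T2: "act2 lam r p g (\<lambda>q. act2 lam r q h f) = A2 - C1" .
  show ?thesis
    using cybe by (simp add: T1 T2 T3 algebra_simps)
qed

lemma poisson_act2:
  assumes M: "manifold M" and act: "left_action smul bracket M lam"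
    and qt: "quasitriangular smul bracket r"
    and skew: "skew_symmetric (act2 lam r)"
  shows "poisson M (act2 lam r)"
  unfolding poisson_def
proof (intro conjI allI impI)
  show "tensor_field M (act2 lam r)"
    using act by (intro tensor_field_act2[OF M]) (simp add: left_action_def)
qed (fact skew act2_jacobi[OF M act qt skew])+

text \<open>
  The sign occurs twice in each term of the Jacobi identity and cancels, as the inner one can be
  pulled out of a tensor.
\<close>

lemma poisson_neg:
  assumes M: "manifold M" and P: "poisson M B"
  shows "poisson M (neg_field B)"
proof -
  have B: "tensor_field M B"
    using P by (simp add: poisson_def)
  have neg: "B p f (\<lambda>q. - B q g h) = - B p f (\<lambda>q. B q g h)"
    if "smooth_near M p g" "smooth_near M p h" for p f g h
  proof (rule tangent2_uminus_right[of "B p" M p "\<lambda>q. B q g h" f])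
    show "B p \<in> tangent_space2 M p"
      using B by (simp add: tensor_field_def)
    show "smooth_near M p (\<lambda>q. B q g h)"
      using B that by (rule tensor_field_smooth_near)
  qed
  have "skew_symmetric B"
    using P by (simp add: poisson_def)
  then have skew: "B p f g = - B p g f" for p f g
    unfolding skew_symmetric_def by (elim allE)
  have jacobi: "\<forall>p f g h. smooth_near M p f \<longrightarrow> smooth_near M p g \<longrightarrow> smooth_near M p h \<longrightarrow>
      B p f (\<lambda>q. B q g h) + B p g (\<lambda>q. B q h f) + B p h (\<lambda>q. B q f g) = 0"
    using P unfolding poisson_def by (elim conjE)
  show ?thesis
    unfolding poisson_def
  proof (intro conjI allI impI)
    show "tensor_field M (neg_field B)"
      by (rule tensor_field_neg[OF M B])
    show "skew_symmetric (neg_field B)"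
      unfolding skew_symmetric_def neg_field_def
    proof (intro allI)
      show "- B p f g = - (- B p g f)" for p f g
        by (simp only: skew[of p f g])
    qed
    show "neg_field B p f (\<lambda>q. neg_field B q g h) + neg_field B p g (\<lambda>q. neg_field B q h f) +
        neg_field B p h (\<lambda>q. neg_field B q f g) = 0"
      if s: "smooth_near M p f" "smooth_near M p g" "smooth_near M p h" for p f g h
      unfolding neg_field_def neg[OF s(2,3)] neg[OF s(3,1)] neg[OF s(1,2)] minus_minus
      by (rule jacobi[THEN spec, THEN spec, THEN spec, THEN spec, THEN mp, THEN mp, THEN mp, OF s])
  qed
qed

section \<open>Compatibility with the cobracket\<close>

lemma act2_ad2:
  assumes act: "left_action smul bracket M lam"
    and f: "smooth_near M p f" and g: "smooth_near M p g"
  shows "act2 lam (ad2 bracket x r) p f g = (\<Sum>i<length r.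
    (lam (fst (r ! i)) p (\<lambda>q. lam x q f) - lam x p (\<lambda>q. lam (fst (r ! i)) q f)) * lam (snd (r ! i)) p g +
    lam (fst (r ! i)) p f * (lam (snd (r ! i)) p (\<lambda>q. lam x q g) - lam x p (\<lambda>q. lam (snd (r ! i)) q g)))"
proof -
  have "act2 lam (ad2 bracket x r) p f g = (\<Sum>(a, b)\<leftarrow>r.
      lam (bracket x a) p f * lam b p g + lam a p f * lam (bracket x b) p g)"
    by (induction r) (auto simp: act2_def ad2_def)
  also have "\<dots> = (\<Sum>(a, b)\<leftarrow>r.
    (lam a p (\<lambda>q. lam x q f) - lam x p (\<lambda>q. lam a q f)) * lam b p g +
    lam a p f * (lam b p (\<lambda>q. lam x q g) - lam x p (\<lambda>q. lam b q g)))"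
    using act f g by (simp add: left_action_def vf_bracket_def)
  finally show ?thesis
    by (simp add: sum_list_pairs_nth)
qed

text \<open>
  By the Leibniz rule the terms \<open>X\<^sub>i(\<lambda>(x) f)\<close> and \<open>Z\<^sub>i(\<lambda>(x) g)\<close> subtracted in the Lie derivative complete the
  second-order terms \<open>\<lambda>(x)(X\<^sub>i f)\<close> and \<open>\<lambda>(x)(Z\<^sub>i g)\<close> to commutators.  If \<open>f\<close> or \<open>g\<close> is not smooth near \<open>p\<close>
  both sides vanish by the convention for tangent vectors.
\<close>

lemma lie_derivative_neg_act2:
  assumes M: "manifold M" and act: "left_action smul bracket M lam"
  shows "lie_derivative M (lam x) (neg_field (act2 lam r)) = act2 lam (ad2 bracket x r)"
proof (intro ext)
  fix p f g
  have vf: "\<And>x. vector_field M (lam x)"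
    using act by (simp add: left_action_def)
  note tan = vector_field_tangent[OF vf]
  show "lie_derivative M (lam x) (neg_field (act2 lam r)) p f g = act2 lam (ad2 bracket x r) p f g"
  proof (cases "smooth_near M p f \<and> smooth_near M p g")
    case False
    then show ?thesis
      using tangent_not_smooth[OF tan] by (auto simp: lie_derivative_def act2_nth)
  next
    case True
    then have f: "smooth_near M p f" and g: "smooth_near M p g"
      by simp_all
    have "lie_derivative M (lam x) (neg_field (act2 lam r)) p f g =
        - lam x p (\<lambda>q. act2 lam r q f g) + act2 lam r p (\<lambda>q. lam x q f) g
        + act2 lam r p f (\<lambda>q. lam x q g)"
      using f g tensor_field_smooth_near[OF tensor_field_act2[where lam = lam, OF M vf] f g, of r]
      by (simp add: lie_derivative_def neg_field_def tangent_uminus[OF tan])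
    also have "\<dots> = act2 lam (ad2 bracket x r) p f g"
      unfolding tangent_act2[where lam = lam, OF M vf tan f g] act2_ad2[OF act f g]
      by (simp add: act2_nth algebra_simps flip: sum_negf sum.distrib)
    finally show ?thesis .
  qed
qed

section \<open>The Poisson space of an r-matrix\<close>

theorem proposition2p18:
  fixes smul :: "'k::{real_normed_field,euclidean_space} \<Rightarrow> 'g::ab_group_add \<Rightarrow> 'g"
    and bracket :: "'g \<Rightarrow> 'g \<Rightarrow> 'g"
    and r :: "('g \<times> 'g) list"
    and Y :: "('a, 'k) manifold_data"
    and lam :: "'g \<Rightarrow> ('a, 'k) vfield"
  assumes "lie_algebra smul bracket"
    and "quasitriangular smul bracket r"
    and "manifold Y"
    and "left_action smul bracket Y lam"
    and "skew_symmetric (act2 lam r)"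
  shows "poisson Y (act2 lam r) \<and>
         left_poisson_space smul bracket r Y (neg_field (act2 lam r)) lam"
proof
  show P: "poisson Y (act2 lam r)"
    by (rule poisson_act2[OF assms(3,4,2,5)])
  show "left_poisson_space smul bracket r Y (neg_field (act2 lam r)) lam"
    unfolding left_poisson_space_def
  proof (intro conjI allI)
    show "manifold Y" "left_action smul bracket Y lam"
      by (fact assms)+
    show "poisson Y (neg_field (act2 lam r))"
      by (rule poisson_neg[OF assms(3) P])
    show "lie_derivative Y (lam x) (neg_field (act2 lam r)) = act2 lam (ad2 bracket x r)" for x
      by (rule lie_derivative_neg_act2[OF assms(3,4)])
  qed
qed

end
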